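(* Let $(S,d)$ be a compact Polish metric space, let $f:S\to\mathbb R$ be lower semicontinuous, let $c:S\times S\to[0,\infty)$ be lower semicontinuous, let $\mu\in P(S)$ and let $r>0$. Let $$v_P:=\inf\left\{\int_{S\times S} f(y)\,d\pi(x,y)\;:\;\pi\in\Pi(\{\mu\},\mathcal B_r(\mu)),\ \int_{S\times S}c(x,y)\,d\pi(x,y)\le r\right\}.$$ Then $v_P=v_D$, where $$v_D:=\sup_{\lambda\ge 0}\left\{\int_S\phi_\lambda(x)\,d\mu(x)-\lambda r\right\},\qquad \phi_\lambda(x):=\min_{y\in S}\{f(y)+\lambda c(x,y)\}.$$
   Context: $P(S)$ and $P(S\times S)$ denote the sets of Borel probability measures on $S$ and $S\times S$. For sets $\mathcal P,\mathcal Q\subseteq P(S)$, $\Pi(\mathcal P,\mathcal Q)$ is the set of all transport plans (couplings) from some element of $\mathcal P$ to some element of $\mathcal Q$, i.e. all $\pi\in P(S\times S)$ whose first marginal belongs to $\mathcal P$ and whose second marginal belongs to $\mathcal Q$. The optimal transport cost is $d_c(\mu,\nu):=\inf\{\int_{S\times S}c(x,y)\,d\pi(x,y):\pi\in\Pi(\{\mu\},\{\nu\})\}$, and $\mathcal B_r(\mu):=\{\nu\in P(S): d_c(\mu,\nu)\le r\}$. The value $v_P$ is that of the transport-plan formulation of the problem of minimizing $\int_S f\,d\nu$ over $\nu\in\mathcal B_r(\mu)$. Integrals of functions bounded below take values in $(-\infty,+\infty]$, and the infimum of the empty set is $+\infty$. *)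

theory Defs
  imports "HOL-Probability.Probability"
begin

definition lower_semicontinuous :: "('a::topological_space \<Rightarrow> real) \<Rightarrow> bool" where
  "lower_semicontinuous f \<longleftrightarrow> (\<forall>x. \<forall>a < f x. \<forall>\<^sub>F y in nhds x. a < f y)"

text \<open>A coupling is a measure on the product space with its Borel sets; for a Polish space
  these coincide with the product sigma-algebra (\<open>borel_prod\<close>).\<close>

abbreviation borel_probs :: "'a::topological_space measure set" where
  "borel_probs \<equiv> space (prob_algebra borel)"

text \<open>The value is the usual one in \<open>(-\<infinity>, \<infinity>]\<close> whenever the negative part has finite
  integral, in particular for measurable functions that are bounded below, under a probability
  measure. The Bochner integral cannot be used since it is 0 for non-integrable functions.\<close>

definition ext_integral :: "'a measure \<Rightarrow> ('a \<Rightarrow> real) \<Rightarrow> ereal" where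
  "ext_integral M g =
     enn2ereal (\<integral>\<^sup>+ x. ennreal (g x) \<partial>M) - enn2ereal (\<integral>\<^sup>+ x. ennreal (- g x) \<partial>M)"

lemma ext_integral_integrable:
  assumes "integrable M g"
  shows "ext_integral M g = ereal (\<integral>x. g x \<partial>M)"
proof -
  have "(\<integral>\<^sup>+ x. ennreal (g x) \<partial>M) \<noteq> \<infinity>" "(\<integral>\<^sup>+ x. ennreal (- g x) \<partial>M) \<noteq> \<infinity>"
    using assms by (simp_all add: real_integrable_def)
  then show ?thesis
    unfolding ext_integral_def real_lebesgue_integral_def[OF assms]
    by (cases "\<integral>\<^sup>+ x. ennreal (g x) \<partial>M"; cases "\<integral>\<^sup>+ x. ennreal (- g x) \<partial>M") auto
qed

definition transport_plans ::
  "'a::topological_space measure set \<Rightarrow> 'a measure set \<Rightarrow> ('a \<times> 'a) measure set" where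
  "transport_plans P Q =
     {\<pi> \<in> borel_probs. distr \<pi> borel fst \<in> P \<and> distr \<pi> borel snd \<in> Q}"

definition ot_cost ::
  "('a::topological_space \<times> 'a \<Rightarrow> real) \<Rightarrow> 'a measure \<Rightarrow> 'a measure \<Rightarrow> ereal" where
  "ot_cost c \<mu> \<nu> = (INF \<pi> \<in> transport_plans {\<mu>} {\<nu>}. ext_integral \<pi> c)"

definition ot_ball ::
  "('a::topological_space \<times> 'a \<Rightarrow> real) \<Rightarrow> real \<Rightarrow> 'a measure \<Rightarrow> 'a measure set" where
  "ot_ball c r \<mu> = {\<nu> \<in> borel_probs. ot_cost c \<mu> \<nu> \<le> ereal r}"

definition primal_value ::
  "('a::topological_space \<Rightarrow> real) \<Rightarrow> ('a \<times> 'a \<Rightarrow> real) \<Rightarrow> 'a measure \<Rightarrow> real \<Rightarrow> ereal" where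
  "primal_value f c \<mu> r =
     (INF \<pi> \<in> {\<pi> \<in> transport_plans {\<mu>} (ot_ball c r \<mu>). ext_integral \<pi> c \<le> ereal r}.
        ext_integral \<pi> (\<lambda>(x, y). f y))"

text \<open>\<open>LEAST\<close> denotes the minimum of the set of values; that it is attained in the setting of
  interest is shown in \<open>dual_potential_attained\<close> below.\<close>

definition dual_potential ::
  "('a \<Rightarrow> real) \<Rightarrow> ('a \<times> 'a \<Rightarrow> real) \<Rightarrow> real \<Rightarrow> 'a \<Rightarrow> real" where
  "dual_potential f c l x = (LEAST m. m \<in> range (\<lambda>y. f y + l * c (x, y)))"

definition dual_value ::
  "('a \<Rightarrow> real) \<Rightarrow> ('a \<times> 'a \<Rightarrow> real) \<Rightarrow> 'a measure \<Rightarrow> real \<Rightarrow> ereal" where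
  "dual_value f c \<mu> r =
     (SUP l \<in> {0..}. ext_integral \<mu> (dual_potential f c l) - ereal (l * r))"

lemma lower_semicontinuous_attains_min:
  fixes g :: "'a::topological_space \<Rightarrow> real"
  assumes "compact (UNIV :: 'a set)" and "lower_semicontinuous g"
  shows "\<exists>y. \<forall>z. g y \<le> g z"
proof (rule ccontr)
  assume "\<not> ?thesis"
  then have *: "\<exists>y. g y < g x" for x
    by (meson not_le)
  define U where "U y = {x. g y < g x}" for y
  have op: "open (U y)" for y
  proof (rule open_subopen[THEN iffD2], rule ballI)
    fix x assume "x \<in> U y"
    then have "\<forall>\<^sub>F z in nhds x. g y < g z"
      using assms(2) by (simp add: U_def lower_semicontinuous_def)
    then obtain T where "open T" "x \<in> T" "\<forall>z\<in>T. g y < g z"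
      by (auto simp only: eventually_nhds)
    then show "\<exists>T. open T \<and> x \<in> T \<and> T \<subseteq> U y"
      by (intro exI[of _ T]) (auto simp: U_def)
  qed
  have "UNIV \<subseteq> (\<Union>y\<in>UNIV. U y)"
    using * by (auto simp: U_def)
  then obtain Y where Y: "finite Y" "UNIV \<subseteq> (\<Union>y\<in>Y. U y)"
    using compactE_image[OF assms(1), of UNIV U] op by metis
  then have "Y \<noteq> {}"
    by auto
  then obtain y0 where y0: "is_arg_min g (\<lambda>y. y \<in> Y) y0"
    using ex_is_arg_min_if_finite[OF Y(1), of g] by blast
  obtain y where "y \<in> Y" "y0 \<in> U y"
    using Y(2) by blast
  with y0 show False
    by (simp add: U_def is_arg_min_def)
qed

lemma dual_potential_attained:
  fixes f :: "'a::topological_space \<Rightarrow> real"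
  assumes "compact (UNIV :: 'a set)" "lower_semicontinuous f" "lower_semicontinuous c" "0 \<le> l"
  obtains y where "dual_potential f c l x = f y + l * c (x, y)"
    and "\<And>z. dual_potential f c l x \<le> f z + l * c (x, z)"
proof -
  have "lower_semicontinuous (\<lambda>y. f y + l * c (x, y))"
    unfolding lower_semicontinuous_def
  proof (intro allI impI)
    fix y a assume a: "a < f y + l * c (x, y)"
    define e where "e = (f y + l * c (x, y) - a) / (l + 1)"
    have e: "0 < e" and ee: "a = f y + l * c (x, y) - e - l * e"
    proof -
      have "e * (l + 1) = f y + l * c (x, y) - a"
        using assms(4) by (simp add: e_def)
      then show "a = f y + l * c (x, y) - e - l * e"
        by (simp add: algebra_simps)
      show "0 < e"
        using a assms(4) by (simp add: e_def)
    qed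
    have "\<forall>\<^sub>F z in nhds y. f y - e < f z"
      using assms(2) e by (auto simp: lower_semicontinuous_def)
    moreover have "\<forall>\<^sub>F p in nhds (x, y). c (x, y) - e < c p"
      using assms(3) e by (auto simp: lower_semicontinuous_def)
    then have "\<forall>\<^sub>F z in nhds y. c (x, y) - e < c (x, z)"
    proof (rule eventually_compose_filterlim)
      show "filterlim (\<lambda>z. (x, z)) (nhds (x, y)) (nhds y)"
        by (intro tendsto_Pair tendsto_const filterlim_ident)
    qed
    ultimately show "\<forall>\<^sub>F z in nhds y. a < f z + l * c (x, z)"
    proof eventually_elim
      case (elim z)
      have "l * (c (x, y) - e) \<le> l * c (x, z)"
        using elim(2) assms(4) by (intro mult_left_mono) auto
      then show ?case
        using elim(1) ee by (simp add: algebra_simps)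
    qed
  qed
  from lower_semicontinuous_attains_min[OF assms(1) this]
  obtain y where y: "\<And>z. f y + l * c (x, y) \<le> f z + l * c (x, z)"
    by auto
  have "dual_potential f c l x = f y + l * c (x, y)"
    unfolding dual_potential_def by (rule Least_equality) (auto simp: y)
  with y show thesis
    by (intro that[of y]) auto
qed

end

theory Submission
  imports Defs
begin

text \<open>Weak duality is the usual Lagrangian estimate. For the converse, a measurable selection
  \<open>T\<^sub>\<lambda>\<close> of the minimizers in \<open>\<phi>\<^sub>\<lambda>\<close> gives a plan on the graph of \<open>T\<^sub>\<lambda>\<close> that minimizes the
  Lagrangian exactly. Let \<open>C(\<lambda>)\<close> be its cost and let \<open>\<lambda>\<close> run through the grid
  \<open>\<epsilon>, 2\<epsilon>, 3\<epsilon>, \<dots>\<close>. If \<open>C(\<epsilon>) \<le> r\<close>, the plan of \<open>\<epsilon>\<close> is feasible and its value exceeds the dual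
  value by at most \<open>\<epsilon> r\<close>. If the cost drops from above \<open>r\<close> to at most \<open>r\<close> between two neighbouring
  grid points, the mixture of the two plans whose cost is \<open>r\<close> has the same property, and no
  derivative of the dual function is needed. If \<open>C(\<lambda>) > r\<close> on the whole grid, the plans are
  compared with the one that minimizes \<open>c(x, \<cdot>)\<close> and, among these minimizers, \<open>f\<close>: by Fatou's lemma
  it is feasible and at least as good as the limit \<open>\<lambda> \<rightarrow> \<infinity>\<close>. This case occurs because
  \<open>c(x, x) = 0\<close> is not assumed.\<close>

section \<open>Lower semicontinuous functions\<close>

lemma lower_semicontinuous_iff_open:
  "lower_semicontinuous h \<longleftrightarrow> (\<forall>a. open {x. a < h x})"
proof -
  have "open {x. a < h x} \<longleftrightarrow> (\<forall>x. a < h x \<longrightarrow> (\<forall>\<^sub>F y in nhds x. a < h y))" for a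
    using eventually_nhds_in_open[of "{x. a < h x}"]
    by (subst open_subopen) (auto simp: eventually_nhds subset_eq)
  then show ?thesis
    by (auto simp: lower_semicontinuous_def)
qed

lemma lower_semicontinuous_closed: "lower_semicontinuous h \<Longrightarrow> closed {x. h x \<le> a}"
  using open_closed[of "{x. a < h x}"]
  by (simp add: lower_semicontinuous_iff_open Compl_eq not_less flip: Collect_neg_eq)

lemma lower_semicontinuous_measurable [measurable]:
  "lower_semicontinuous h \<Longrightarrow> h \<in> borel_measurable borel"
  by (rule borel_measurableI_le) (simp add: lower_semicontinuous_closed)

lemma lower_semicontinuous_compose:
  assumes "lower_semicontinuous h" "continuous_on UNIV g"
  shows "lower_semicontinuous (\<lambda>x. h (g x))"
  unfolding lower_semicontinuous_iff_open
proof
  fix a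
  show "open {x. a < h (g x)}"
    using open_vimage[of "{y. a < h y}" g] assms
    by (simp add: lower_semicontinuous_iff_open vimage_def)
qed

lemma continuous_imp_lower_semicontinuous:
  "continuous_on UNIV h \<Longrightarrow> lower_semicontinuous h"
  unfolding lower_semicontinuous_iff_open
  by (intro allI open_Collect_less continuous_on_const)

lemma lower_semicontinuous_add:
  assumes "lower_semicontinuous g" "lower_semicontinuous h"
  shows "lower_semicontinuous (\<lambda>x. g x + h x)"
  unfolding lower_semicontinuous_def
proof (intro allI impI)
  fix x a assume a: "a < g x + h x"
  define e where "e = (g x + h x - a) / 2"
  have e: "0 < e"
    using a by (simp add: e_def)
  have "\<forall>\<^sub>F y in nhds x. g x - e < g y" "\<forall>\<^sub>F y in nhds x. h x - e < h y"
    using assms e by (simp_all add: lower_semicontinuous_def)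
  then show "\<forall>\<^sub>F y in nhds x. a < g y + h y"
    by eventually_elim (simp add: e_def field_simps)
qed

lemma lower_semicontinuous_cmult:
  assumes "lower_semicontinuous h" "0 \<le> (l::real)"
  shows "lower_semicontinuous (\<lambda>x. l * h x)"
proof (cases "l = 0")
  case True
  then show ?thesis
    by (simp add: continuous_imp_lower_semicontinuous)
next
  case False
  then have "{x. a < l * h x} = {x. a / l < h x}" for a
    using assms(2) by (auto simp: field_simps)
  then show ?thesis
    using assms(1) by (simp add: lower_semicontinuous_iff_open)
qed

text \<open>If no point of \<open>K\<close> were a minimizer, the open sets
  \<open>{x. h y < h x}\<close> with \<open>y\<close> in \<open>K\<close> would cover
  \<open>K\<close>. A point minimizing \<open>h\<close> over the finite index set of a subcover lies
  in no member of that subcover.\<close>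

lemma lower_semicontinuous_attains_min_on:
  assumes "lower_semicontinuous h" "compact K" "K \<noteq> {}"
  shows "\<exists>y\<in>K. \<forall>z\<in>K. h y \<le> h z"
proof (rule ccontr)
  assume "\<not> ?thesis"
  then have "K \<subseteq> (\<Union>y\<in>K. {x. h y < h x})"
    by (auto simp: not_le)
  moreover have "\<And>y. y \<in> K \<Longrightarrow> open {x. h y < h x}"
    using assms(1) by (simp add: lower_semicontinuous_iff_open)
  ultimately obtain Y where Y: "Y \<subseteq> K" "finite Y" "K \<subseteq> (\<Union>y\<in>Y. {x. h y < h x})"
    using compactE_image[OF assms(2)] by metis
  with assms(3) have "Y \<noteq> {}"
    by auto
  then obtain y0 where y0: "is_arg_min h (\<lambda>y. y \<in> Y) y0"
    using ex_is_arg_min_if_finite[OF Y(2), of h] by blast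
  then have "y0 \<in> K"
    using Y(1) by (auto simp: is_arg_min_def)
  with Y(3) obtain y where "y \<in> Y" "h y < h y0"
    by blast
  with y0 show False
    by (simp add: is_arg_min_def)
qed

section \<open>Measurable selection of minimizers\<close>

text \<open>The closed sets \<open>F\<close> live in the product, not just in the codomain. They can
  thus be intersected with a sublevel set of a cost that depends on both variables, which is what
  lets the property pass to sets of minimizers.\<close>

definition hit_measurable :: "('a::topological_space \<Rightarrow> 'b::topological_space set) \<Rightarrow> bool" where
  "hit_measurable K \<longleftrightarrow> (\<forall>x. closed (K x) \<and> K x \<noteq> {}) \<and>
     (\<forall>F. closed F \<longrightarrow> {x. \<exists>y\<in>K x. (x, y) \<in> F} \<in> sets borel)"

definition argmin_on :: "('a \<times> 'b \<Rightarrow> real) \<Rightarrow> ('a \<Rightarrow> 'b set) \<Rightarrow> 'a \<Rightarrow> 'b set" where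
  "argmin_on h K x = {y \<in> K x. \<forall>z\<in>K x. h (x, y) \<le> h (x, z)}"

text \<open>The hit set of \<open>F\<close> is its projection to the first factor, a continuous
  image of a compact set and hence closed.\<close>

lemma hit_measurable_UNIV:
  assumes "compact (UNIV :: 'a::t2_space set)" "compact (UNIV :: 'b::topological_space set)"
  shows "hit_measurable (\<lambda>x::'a. UNIV :: 'b set)"
proof -
  have "closed {x. \<exists>y. (x, y) \<in> F}" if "closed F" for F :: "('a \<times> 'b) set"
  proof -
    have "compact F"
      using compact_Int_closed[OF compact_Times[OF assms] that] by simp
    then have "compact (fst ` F)"
      by (intro compact_continuous_image continuous_intros)
    moreover have "fst ` F = {x. \<exists>y. (x, y) \<in> F}"
      by force
    ultimately show ?thesis
      by (simp add: compact_imp_closed)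
  qed
  then show ?thesis
    by (simp add: hit_measurable_def)
qed

text \<open>The minimizers over \<open>K x\<close> miss \<open>F\<close> iff some rational \<open>q\<close> bounds the minimum over \<open>K x\<close> from
  above while the sublevel set of \<open>q\<close> within \<open>K x\<close> misses \<open>F\<close>.\<close>

lemma hit_measurable_argmin_on:
  fixes K :: "'a::topological_space \<Rightarrow> 'b::topological_space set"
  assumes compact: "compact (UNIV :: 'b set)"
    and K: "hit_measurable K" and h: "lower_semicontinuous h"
  shows "hit_measurable (argmin_on h K)"
proof -
  have slice: "lower_semicontinuous (\<lambda>y. h (x, y))" for x
    by (intro lower_semicontinuous_compose[OF h] continuous_intros)
  have cpt: "compact (K x \<inter> C)" if "closed C" for x C
    using compact_Int_closed[OF compact, of "K x \<inter> C"] K that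
    by (simp add: hit_measurable_def closed_Int)
  have nonempty: "argmin_on h K x \<noteq> {}" for x
    using lower_semicontinuous_attains_min_on[OF slice, of "K x" x] cpt[of UNIV] K
    by (auto simp: argmin_on_def hit_measurable_def)
  have closed: "closed (argmin_on h K x)" for x
  proof -
    have "argmin_on h K x = K x \<inter> (\<Inter>z\<in>K x. {y. h (x, y) \<le> h (x, z)})"
      by (auto simp: argmin_on_def)
    then show ?thesis
      using K lower_semicontinuous_closed[OF slice]
      by (auto simp: hit_measurable_def intro!: closed_Int closed_INT)
  qed
  have "{x. \<exists>y\<in>argmin_on h K x. (x, y) \<in> F} \<in> sets borel" if F: "closed F" for F
  proof -
    let ?hit = "\<lambda>q C. {x. \<exists>y\<in>K x. (x, y) \<in> C \<inter> {p. h p \<le> q}}"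
    have eq: "{x. \<exists>y\<in>argmin_on h K x. (x, y) \<in> F} =
        UNIV - (\<Union>q\<in>\<rat>. ?hit q UNIV - ?hit q F)" (is "?L = ?R")
    proof (intro set_eqI iffI)
      fix x assume "x \<in> ?L"
      then obtain y where y: "y \<in> K x" "\<forall>z\<in>K x. h (x, y) \<le> h (x, z)" "(x, y) \<in> F"
        by (auto simp: argmin_on_def)
      have "x \<in> ?hit q F" if hit: "x \<in> ?hit q UNIV" for q
      proof -
        obtain z where "z \<in> K x" "h (x, z) \<le> q"
          using hit by auto
        then have "h (x, y) \<le> q"
          using y(2) by (blast intro: order_trans)
        then show ?thesis
          using y by auto
      qed
      then show "x \<in> ?R"
        by blast
    next
      fix x assume R: "x \<in> ?R"
      obtain y where y: "y \<in> argmin_on h K x"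
        using nonempty by blast
      have hit: "\<exists>z\<in>K x. (x, z) \<in> F \<and> h (x, z) \<le> q" if "q \<in> \<rat>" "h (x, y) \<le> q" for q
      proof -
        have "x \<in> ?hit q UNIV"
          using y that by (auto simp: argmin_on_def)
        then have "x \<in> ?hit q F"
          using R that(1) by blast
        then show ?thesis
          by auto
      qed
      \<comment> \<open>The slice of \<open>F\<close> within \<open>K x\<close> is compact, so
        \<open>h (x, _)\<close> has a minimizer \<open>z\<close> on it once a rational above
        \<open>h (x, y)\<close> shows that it is nonempty.\<close>
      have "closed {z. (x, z) \<in> F}"
        using F closed_vimage[of F "Pair x"]
        by (simp add: vimage_def continuous_intros)
      note cptF = cpt[OF this, of x]
      obtain q where "q \<in> \<rat>" "h (x, y) < q"
        using Rats_dense_in_real[of "h (x, y)" "h (x, y) + 1"] by auto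
      then have "K x \<inter> {z. (x, z) \<in> F} \<noteq> {}"
        using hit[of q] by auto
      from lower_semicontinuous_attains_min_on[OF slice[of x] cptF this]
      obtain z where z: "z \<in> K x" "(x, z) \<in> F"
        "\<And>z'. z' \<in> K x \<Longrightarrow> (x, z') \<in> F \<Longrightarrow> h (x, z) \<le> h (x, z')"
        by auto
      \<comment> \<open>A rational strictly between the two values would yield a point of the slice
        on which \<open>h\<close> is smaller than at \<open>z\<close>.\<close>
      have "h (x, z) \<le> h (x, y)"
      proof (rule ccontr)
        assume "\<not> ?thesis"
        then obtain q where "q \<in> \<rat>" "h (x, y) < q" "q < h (x, z)"
          using Rats_dense_in_real[of "h (x, y)" "h (x, z)"] by auto
        moreover from this obtain z' where "z' \<in> K x" "(x, z') \<in> F" "h (x, z') \<le> q"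
          using hit[of q] by auto
        ultimately show False
          using z(3)[of z'] by simp
      qed
      then show "x \<in> ?L"
        using y z(1,2) by (fastforce simp: argmin_on_def intro: bexI[of _ z])
    qed
    have hit: "?hit q C \<in> sets borel" if "closed C" for q C
      using K closed_Int[OF that lower_semicontinuous_closed[OF h]]
      unfolding hit_measurable_def by blast
    have "(\<Union>q\<in>\<rat>. ?hit q UNIV - ?hit q F) \<in> sets borel"
      by (intro sets.countable_UN' countable_rat sets.Diff hit closed_UNIV F image_subsetI)
    then show ?thesis
      unfolding eq Compl_eq_Diff_UNIV[symmetric] by (rule borel_comp)
  qed
  with closed nonempty show ?thesis
    by (simp add: hit_measurable_def)
qed

text \<open>An open set is the union of the balls inside it that have a centre \<open>q n\<close>
  and a radius \<open>inverse (real (Suc k))\<close>. There are countably many of them, and the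
  preimage of each is a sublevel set of one distance function.\<close>

lemma measurable_if_dist_measurable:
  fixes T :: "'a \<Rightarrow> 'b::{metric_space, second_countable_topology}"
  assumes q: "\<And>U::'b set. open U \<Longrightarrow> U \<noteq> {} \<Longrightarrow> \<exists>n::nat. q n \<in> U"
    and m: "\<And>n. (\<lambda>x. dist (q n) (T x)) \<in> borel_measurable M"
  shows "T \<in> borel_measurable M"
proof (rule borel_measurableI)
  fix U :: "'b set" assume U: "open U"
  define I where "I = {(n, k). ball (q n) (inverse (real (Suc k))) \<subseteq> U}"
  have "U \<subseteq> (\<Union>(n, k)\<in>I. ball (q n) (inverse (real (Suc k))))"
  proof
    fix y assume "y \<in> U"
    then obtain e where e: "0 < e" "ball y e \<subseteq> U"
      using U openE by blast
    \<comment> \<open>Half of \<open>e\<close>, since the radius is spent twice: from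
      \<open>y\<close> to the centre \<open>q n\<close>, and from there to any point of its
      ball.\<close>
    then obtain k where k: "inverse (real (Suc k)) < e / 2"
      using reals_Archimedean[of "e / 2"] by auto
    obtain n where n: "q n \<in> ball y (inverse (real (Suc k)))"
      using q[of "ball y (inverse (real (Suc k)))"] by auto
    have "ball (q n) (inverse (real (Suc k))) \<subseteq> ball y e"
    proof
      fix z assume "z \<in> ball (q n) (inverse (real (Suc k)))"
      then show "z \<in> ball y e"
        using n k dist_triangle[of y z "q n"] by simp
    qed
    then show "y \<in> (\<Union>(n, k)\<in>I. ball (q n) (inverse (real (Suc k))))"
      using n e(2) by (auto simp: I_def dist_commute intro!: bexI[of _ "(n, k)"])
  qed
  then have "U = (\<Union>(n, k)\<in>I. ball (q n) (inverse (real (Suc k))))"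
    by (auto simp: I_def)
  then have "T -` U \<inter> space M =
      (\<Union>(n, k)\<in>I. {x \<in> space M. dist (q n) (T x) < inverse (real (Suc k))})"
    by force
  also have "\<dots> \<in> sets M"
    using m by (intro sets.countable_UN') (auto intro!: borel_measurable_less)
  finally show "T -` U \<inter> space M \<in> sets M" .
qed

text \<open>Successively minimizing the distances to the points \<open>q 0, q 1, \<dots>\<close> of a dense sequence leaves a
  nonempty intersection; each distance \<open>dist (q n) (T x)\<close> of a point \<open>T x\<close> chosen from it is a minimum
  over a hit-measurable correspondence, so the choice is automatically measurable.\<close>

lemma measurable_selector:
  fixes K :: "'a::topological_space \<Rightarrow> 'b::{metric_space, second_countable_topology} set"
  assumes compact: "compact (UNIV :: 'b set)" and K: "hit_measurable K"
  obtains T where "T \<in> borel_measurable borel" "\<And>x. T x \<in> K x"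
proof -
  obtain D :: "'b set" where D: "countable D" "\<And>U. open U \<Longrightarrow> U \<noteq> {} \<Longrightarrow> \<exists>d\<in>D. d \<in> U"
    using countable_dense_setE by blast
  then have "D \<noteq> {}"
    by (metis empty_iff open_UNIV UNIV_not_empty)
  define q where "q = from_nat_into D"
  have q: "\<exists>n. q n \<in> U" if "open U" "U \<noteq> {}" for U
    using D(2)[OF that] from_nat_into_surj[OF D(1)] by (metis q_def)
  define L where "L = rec_nat K (\<lambda>n. argmin_on (\<lambda>(x, y). dist (q n) y))"
  have L_0: "L 0 = K" and L_Suc: "L (Suc n) = argmin_on (\<lambda>(x, y). dist (q n) y) (L n)" for n
    by (simp_all add: L_def)
  have hm: "hit_measurable (L n)" for n
  proof (induction n)
    case (Suc n)
    then show ?case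
      unfolding L_Suc case_prod_beta
      by (intro hit_measurable_argmin_on compact continuous_imp_lower_semicontinuous
          continuous_intros)
  qed (simp add: L_0 K)
  have anti: "L n x \<subseteq> L m x" if "m \<le> n" for m n x
    using that by (induction rule: dec_induct) (auto simp: L_Suc argmin_on_def)
  \<comment> \<open>The sets \<open>L n x\<close> are closed, nonempty and decreasing in
    \<open>n\<close>, so compactness gives a common point.\<close>
  have "UNIV \<inter> (\<Inter>n\<in>UNIV. L n x) \<noteq> {}" for x
  proof (rule compact_imp_fip_image[OF compact])
    show "closed (L n x)" for n
      using hm by (simp add: hit_measurable_def)
    fix I :: "nat set" assume "finite I"
    then obtain n where "\<forall>m\<in>I. m \<le> n"
      using finite_nat_set_iff_bounded_le by auto
    then have "L n x \<subseteq> (\<Inter>m\<in>I. L m x)"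
      using anti by blast
    then show "UNIV \<inter> (\<Inter>m\<in>I. L m x) \<noteq> {}"
      using hm[of n] by (auto simp: hit_measurable_def)
  qed
then have "\<forall>x. \<exists>y. \<forall>n. y \<in> L n x"
    by blast
  then obtain T where T: "\<And>x n. T x \<in> L n x"
    by metis
  have "(\<lambda>x. dist (q n) (T x)) \<in> borel_measurable borel" for n
  proof (rule borel_measurableI_le)
    fix a
    let ?F = "{p :: 'a \<times> 'b. dist (q n) (snd p) \<le> a}"
    \<comment> \<open>Membership of \<open>T x\<close> in \<open>L (Suc n) x\<close> makes its
      distance the minimum over \<open>L n x\<close>. The sublevel set is therefore a hit set of
      \<open>L n\<close>, in whose description \<open>T\<close> no longer occurs.\<close>
    have "dist (q n) (T x) \<le> dist (q n) y" if "y \<in> L n x" for x y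
      using T[of x "Suc n"] that by (auto simp: L_Suc argmin_on_def)
    then have "{x. dist (q n) (T x) \<le> a} = {x. \<exists>y\<in>L n x. (x, y) \<in> ?F}"
      using T by (auto intro: order_trans)
    moreover have "closed ?F"
      by (intro closed_Collect_le continuous_intros)
    then have "{x. \<exists>y\<in>L n x. (x, y) \<in> ?F} \<in> sets borel"
      using hm[of n] unfolding hit_measurable_def by blast
    ultimately have "{x. dist (q n) (T x) \<le> a} \<in> sets borel"
      by (rule ssubst)
    then show "{x \<in> space borel. dist (q n) (T x) \<le> a} \<in> sets borel"
      by simp
  qed
  then have "T \<in> borel_measurable borel"
    by (intro measurable_if_dist_measurable[of q] q)
  then show thesis
    using T[of _ 0] by (intro that) (auto simp: L_0)
qed

text \<open>Two nested argmin correspondences express the priority of \<open>g\<close> over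
  \<open>h\<close>. The condition \<open>g (x, y) \<le> g (x, T x)\<close> says that
  \<open>y\<close> minimizes \<open>g (x, _)\<close> too.\<close>

lemma measurable_lexicographic_argmin:
  fixes g h :: "'a::t2_space \<times> 'b::{metric_space, second_countable_topology} \<Rightarrow> real"
  assumes "compact (UNIV :: 'a set)" "compact (UNIV :: 'b set)"
    and "lower_semicontinuous g" "lower_semicontinuous h"
  obtains T where "T \<in> borel_measurable borel" "\<And>x y. g (x, T x) \<le> g (x, y)"
    "\<And>x y. g (x, y) \<le> g (x, T x) \<Longrightarrow> h (x, T x) \<le> h (x, y)"
proof -
  have "hit_measurable (argmin_on h (argmin_on g (\<lambda>x. UNIV)))"
    using assms by (intro hit_measurable_argmin_on hit_measurable_UNIV)
  from measurable_selector[OF assms(2) this] obtain T where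
    T: "T \<in> borel_measurable borel" "\<And>x. T x \<in> argmin_on h (argmin_on g (\<lambda>x. UNIV)) x"
    by blast
  show thesis
  proof
    show "T \<in> borel_measurable borel" by fact
    show "g (x, T x) \<le> g (x, y)" for x y
      using T(2)[of x] by (simp add: argmin_on_def)
    then show "h (x, T x) \<le> h (x, y)" if "g (x, y) \<le> g (x, T x)" for x y
      using T(2)[of x] that unfolding argmin_on_def by (simp, meson order_trans)
  qed
qed

section \<open>Integrals and mixtures\<close>

text \<open>The lower bound makes the integral of the negative part finite, so integrability can
  fail only through an infinite positive part.\<close>

lemma ext_integral_bounded_below:
  assumes "finite_measure M" "g \<in> borel_measurable M" "\<And>x. b \<le> g x"
  shows "ext_integral M g = (if integrable M g then ereal (\<integral>x. g x \<partial>M) else \<infinity>)"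
proof (cases "integrable M g")
  case False
  interpret finite_measure M by fact
  have "(\<integral>\<^sup>+ x. ennreal (- g x) \<partial>M) \<le> (\<integral>\<^sup>+ x. ennreal (- b) \<partial>M)"
    using assms(3) by (intro nn_integral_mono ennreal_leI) simp
  also have "\<dots> < \<infinity>"
    using emeasure_finite[of "space M"] by (simp add: ennreal_mult_less_top emeasure_eq_measure)
  finally have neg: "(\<integral>\<^sup>+ x. ennreal (- g x) \<partial>M) < \<infinity>" .
  then have "(\<integral>\<^sup>+ x. ennreal (g x) \<partial>M) = \<infinity>"
    using False assms(2) by (auto simp: real_integrable_def)
  then show ?thesis
    using False neg unfolding ext_integral_def
    by (cases "\<integral>\<^sup>+ x. ennreal (- g x) \<partial>M") auto
qed (simp add: ext_integral_integrable)

text \<open>A Bernoulli coin with parameter \<open>a\<close> decides whether to sample from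
  \<open>P\<close> or from \<open>Q\<close>; the bind of this experiment is the convex combination
  of the two measures.\<close>

lemma mixture_exists:
  fixes a :: real
  assumes P: "P \<in> space (prob_algebra N)" and Q: "Q \<in> space (prob_algebra N)"
    and a: "0 \<le> a" "a \<le> 1"
  obtains R where "R \<in> space (prob_algebra N)"
    "\<And>g. g \<in> borel_measurable N \<Longrightarrow>
      (\<integral>\<^sup>+x. g x \<partial>R) = (\<integral>\<^sup>+x. g x \<partial>P) * ennreal a + (\<integral>\<^sup>+x. g x \<partial>Q) * ennreal (1 - a)"
proof -
  let ?B = "measure_pmf (bernoulli_pmf a)" and ?K = "\<lambda>b. if b then P else Q"
  have K: "?K \<in> ?B \<rightarrow>\<^sub>M prob_algebra N"
    using P Q by simp
  have B: "?B \<in> space (prob_algebra ?B)"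
    by (simp add: space_prob_algebra measure_pmf.prob_space_axioms)
  have "?B \<bind> ?K \<in> space (prob_algebra N)"
    using measurable_space[OF measurable_bind_prob_space[OF measurable_ident K] B] by simp
  moreover have "(\<integral>\<^sup>+x. g x \<partial>(?B \<bind> ?K)) =
      (\<integral>\<^sup>+x. g x \<partial>P) * ennreal a + (\<integral>\<^sup>+x. g x \<partial>Q) * ennreal (1 - a)"
    if "g \<in> borel_measurable N" for g
    using nn_integral_bind[OF that measurable_prob_algebraD[OF K]] a by simp
  ultimately show thesis
    by (rule that)
qed

text \<open>The identity for nonnegative integrals is applied to the positive and the negative part
  of \<open>g\<close>. All four integrals under \<open>P\<close> and \<open>Q\<close> are finite, so
  the results are real and can be subtracted.\<close>

lemma mixture_has_bochner_integral:
  fixes g :: "'a \<Rightarrow> real"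
  assumes R: "\<And>g. g \<in> borel_measurable N \<Longrightarrow>
      (\<integral>\<^sup>+x. g x \<partial>R) = (\<integral>\<^sup>+x. g x \<partial>P) * ennreal a + (\<integral>\<^sup>+x. g x \<partial>Q) * ennreal (1 - a)"
    and sets: "sets R = sets N" "sets P = sets N" "sets Q = sets N"
    and a: "0 \<le> a" "a \<le> 1"
    and P: "integrable P g" and Q: "integrable Q g"
  shows "has_bochner_integral R g (a * (\<integral>x. g x \<partial>P) + (1 - a) * (\<integral>x. g x \<partial>Q))"
proof -
  have g: "g \<in> borel_measurable N"
    using borel_measurable_integrable[OF P] sets by (simp cong: measurable_cong_sets)
  have pos: "(\<integral>\<^sup>+x. ennreal (h x) \<partial>R) =
      ennreal (a * enn2real (\<integral>\<^sup>+x. ennreal (h x) \<partial>P) + (1 - a) * enn2real (\<integral>\<^sup>+x. ennreal (h x) \<partial>Q))"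
    if "h \<in> borel_measurable N" "(\<integral>\<^sup>+x. ennreal (h x) \<partial>P) \<noteq> \<infinity>" "(\<integral>\<^sup>+x. ennreal (h x) \<partial>Q) \<noteq> \<infinity>"
    for h :: "'a \<Rightarrow> real"
    using that R[of "\<lambda>x. ennreal (h x)"] a
    by (cases "\<integral>\<^sup>+x. ennreal (h x) \<partial>P"; cases "\<integral>\<^sup>+x. ennreal (h x) \<partial>Q")
      (auto simp: ennreal_mult ennreal_plus mult.commute)
  have fin: "(\<integral>\<^sup>+x. ennreal (g x) \<partial>P) \<noteq> \<infinity>" "(\<integral>\<^sup>+x. ennreal (- g x) \<partial>P) \<noteq> \<infinity>"
    "(\<integral>\<^sup>+x. ennreal (g x) \<partial>Q) \<noteq> \<infinity>" "(\<integral>\<^sup>+x. ennreal (- g x) \<partial>Q) \<noteq> \<infinity>"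
    using P Q by (simp_all add: real_integrable_def)
  note pos_g = pos[OF g fin(1,3)]
  have pos_neg: "(\<integral>\<^sup>+x. ennreal (- g x) \<partial>R) = ennreal (a * enn2real (\<integral>\<^sup>+x. ennreal (- g x) \<partial>P)
      + (1 - a) * enn2real (\<integral>\<^sup>+x. ennreal (- g x) \<partial>Q))"
    using g fin by (intro pos) auto
  have int: "integrable R g"
    unfolding real_integrable_def pos_g pos_neg
    using g sets by (simp cong: measurable_cong_sets)
  have real: "enn2real (ennreal (a * enn2real s + (1 - a) * enn2real t)) =
      a * enn2real s + (1 - a) * enn2real t" for s t
    using a by (intro enn2real_ennreal add_nonneg_nonneg mult_nonneg_nonneg) auto
  show ?thesis
    using int unfolding has_bochner_integral_iff real_lebesgue_integral_def[OF int]
      real_lebesgue_integral_def[OF P] real_lebesgue_integral_def[OF Q] pos_g pos_neg real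
    by (simp add: algebra_simps)
qed

text \<open>Indicators pulled back along \<open>h\<close> reduce this to the integral identity. With
  \<open>h = fst\<close> it keeps the first marginal of a mixture of plans at \<mu>.\<close>

lemma mixture_distr:
  assumes R: "\<And>g. g \<in> borel_measurable N \<Longrightarrow>
      (\<integral>\<^sup>+x. g x \<partial>R) = (\<integral>\<^sup>+x. g x \<partial>P) * ennreal a + (\<integral>\<^sup>+x. g x \<partial>Q) * ennreal (1 - a)"
    and sets: "sets R = sets N" "sets P = sets N" "sets Q = sets N"
    and a: "0 \<le> a" "a \<le> 1"
    and h: "h \<in> N \<rightarrow>\<^sub>M L" and eq: "distr P L h = D" "distr Q L h = D"
  shows "distr R L h = D"
proof (rule measure_eqI)
  show "sets (distr R L h) = sets D"
    using eq by auto
  fix A assume "A \<in> sets (distr R L h)"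
  then have A: "A \<in> sets L"
    by simp
  have m: "h \<in> R \<rightarrow>\<^sub>M L" "h \<in> P \<rightarrow>\<^sub>M L" "h \<in> Q \<rightarrow>\<^sub>M L"
    using h sets by (simp_all cong: measurable_cong_sets)
  have "emeasure (distr R L h) A = (\<integral>\<^sup>+x. indicator A (h x) \<partial>R)"
    using A m nn_integral_distr[OF m(1), of "indicator A"] by simp
  also have "\<dots> = (\<integral>\<^sup>+x. indicator A (h x) \<partial>P) * ennreal a
      + (\<integral>\<^sup>+x. indicator A (h x) \<partial>Q) * ennreal (1 - a)"
    using A h by (intro R) auto
  also have "\<dots> = emeasure (distr P L h) A * ennreal a + emeasure (distr Q L h) A * ennreal (1 - a)"
    using A m nn_integral_distr[OF m(2), of "indicator A"] nn_integral_distr[OF m(3), of "indicator A"]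
    by simp
  also have "\<dots> = emeasure D A * ennreal (a + (1 - a))"
    unfolding eq using a by (subst ennreal_plus) (auto simp: distrib_left)
  finally show "emeasure (distr R L h) A = emeasure D A"
    by simp
qed

section \<open>Duality\<close>

lemma borel_measurable_fst: "fst \<in> borel \<rightarrow>\<^sub>M borel"
  by (rule borel_measurable_continuous_onI[OF continuous_on_fst[OF continuous_on_id]])

lemma borel_measurable_snd: "snd \<in> borel \<rightarrow>\<^sub>M borel"
  by (rule borel_measurable_continuous_onI[OF continuous_on_snd[OF continuous_on_id]])

text \<open>Membership of the second marginal in the ball is implied by the cost constraint.\<close>

lemma primal_value_eq:
  "primal_value f c \<mu> r =
    (INF \<pi> \<in> {\<pi> \<in> borel_probs. distr \<pi> borel fst = \<mu> \<and> ext_integral \<pi> c \<le> ereal r}.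
      ext_integral \<pi> (\<lambda>(x, y). f y))"
proof -
  have "distr \<pi> borel snd \<in> ot_ball c r \<mu>"
    if \<pi>: "\<pi> \<in> borel_probs" "distr \<pi> borel fst = \<mu>" "ext_integral \<pi> c \<le> ereal r" for \<pi>
  proof -
    have "ot_cost c \<mu> (distr \<pi> borel snd) \<le> ext_integral \<pi> c"
      unfolding ot_cost_def using \<pi> by (intro INF_lower) (auto simp: transport_plans_def)
    moreover have "distr \<pi> borel snd \<in> borel_probs"
      using measurable_space[OF measurable_distr_prob_space[OF borel_measurable_snd] \<pi>(1)] .
    ultimately show ?thesis
      using \<pi>(3) by (auto simp: ot_ball_def)
  qed
  then have "{\<pi> \<in> transport_plans {\<mu>} (ot_ball c r \<mu>). ext_integral \<pi> c \<le> ereal r} =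
      {\<pi> \<in> borel_probs. distr \<pi> borel fst = \<mu> \<and> ext_integral \<pi> c \<le> ereal r}"
    by (auto simp: transport_plans_def)
  then show ?thesis
    by (simp add: primal_value_def)
qed

section \<open>Setting, optimal maps and measurability of the dual potential\<close>

locale transport_problem =
  fixes f :: "'a::polish_space \<Rightarrow> real" and c :: "'a \<times> 'a \<Rightarrow> real"
    and \<mu> :: "'a measure" and r :: real
  assumes compact_UNIV: "compact (UNIV :: 'a set)"
    and lsc_f: "lower_semicontinuous f" and lsc_c: "lower_semicontinuous c"
    and c_nonneg: "\<And>p. 0 \<le> c p"
    and prob: "\<mu> \<in> borel_probs"
    and r_nonneg: "0 \<le> r"
begin

sublocale prob_space \<mu>
  using prob by (simp add: space_prob_algebra)

lemma sets_mu [measurable_cong]: "sets \<mu> = sets borel"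
  using prob by (simp add: space_prob_algebra)

lemma measurable_f [measurable]: "f \<in> borel_measurable borel"
  by (rule lower_semicontinuous_measurable[OF lsc_f])

lemma measurable_c [measurable]: "c \<in> borel_measurable borel"
  by (rule lower_semicontinuous_measurable[OF lsc_c])

lemma measurable_f_snd [measurable]: "(\<lambda>(x, y). f y) \<in> borel_measurable borel"
  using measurable_compose[OF borel_measurable_snd measurable_f] by (simp add: case_prod_beta')

lemma f_bounded_below: obtains b where "\<And>y. b \<le> f y"
  using lower_semicontinuous_attains_min[OF compact_UNIV lsc_f] that by auto

lemma lsc_lagrangian:
  assumes "0 \<le> l"
  shows "lower_semicontinuous (\<lambda>(x, y). f y + l * c (x, y))"
  using lower_semicontinuous_add[OF lower_semicontinuous_compose[OF lsc_f continuous_on_snd[OF continuous_on_id]]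
      lower_semicontinuous_cmult[OF lsc_c assms]]
  by (simp add: case_prod_beta')

lemma dual_potential_le:
  assumes "0 \<le> l"
  shows "dual_potential f c l x \<le> f y + l * c (x, y)"
  by (rule dual_potential_attained[OF compact_UNIV lsc_f lsc_c assms])

lemma optimal_map:
  assumes "0 \<le> l"
  obtains T where "T \<in> borel_measurable borel"
    "\<And>x. dual_potential f c l x = f (T x) + l * c (x, T x)"
proof -
  obtain T where T: "T \<in> borel_measurable borel"
    "\<And>x y. f (T x) + l * c (x, T x) \<le> f y + l * c (x, y)"
    \<comment> \<open>Both criteria are the Lagrangian, as any measurable choice of a minimizer will
      do.\<close>
    using measurable_lexicographic_argmin[OF compact_UNIV compact_UNIV
        lsc_lagrangian[OF assms] lsc_lagrangian[OF assms]] by auto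
  have "dual_potential f c l x = f (T x) + l * c (x, T x)" for x
    using dual_potential_attained[OF compact_UNIV lsc_f lsc_c assms, of x] T(2)
      dual_potential_le[OF assms] by (metis order_antisym)
  with T(1) show thesis
    by (rule that)
qed

lemma measurable_graph:
  fixes T :: "'a \<Rightarrow> 'a"
  assumes "T \<in> borel_measurable borel"
  shows "(\<lambda>x. (x, T x)) \<in> \<mu> \<rightarrow>\<^sub>M borel"
  unfolding measurable_cong_sets[OF sets_mu refl]
  by (rule borel_measurable_Pair[OF measurable_ident assms, unfolded id_def])

text \<open>A minimum over uncountably many \<open>y\<close> is not measurable on general grounds;
  evaluated along an optimal map it becomes a composition of measurable functions.\<close>

lemma measurable_dual_potential:
  assumes "0 \<le> l"
  shows "dual_potential f c l \<in> borel_measurable borel"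
proof -
  obtain T where T [measurable]: "T \<in> borel_measurable borel"
    and eq: "\<And>x. dual_potential f c l x = f (T x) + l * c (x, T x)"
    using optimal_map[OF assms] by blast
  have [measurable]: "(\<lambda>x. (x, T x)) \<in> borel \<rightarrow>\<^sub>M borel"
    by (intro borel_measurable_Pair) measurable
  have "(\<lambda>x. f (T x) + l * c (x, T x)) \<in> borel_measurable borel"
    by measurable
  then show ?thesis
    by (simp add: eq[abs_def])
qed

lemma dual_potential_ge:
  assumes "0 \<le> l" "\<And>y. b \<le> f y"
  shows "b \<le> dual_potential f c l x"
proof -
  obtain y where "dual_potential f c l x = f y + l * c (x, y)"
    using dual_potential_attained[OF compact_UNIV lsc_f lsc_c assms(1)] by blast
  then show ?thesis
    using assms c_nonneg[of "(x, y)"] by (simp add: add_increasing2)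
qed

lemma ext_integral_dual_potential:
  assumes "0 \<le> l"
  shows "ext_integral \<mu> (dual_potential f c l) =
    (if integrable \<mu> (dual_potential f c l) then ereal (\<integral>x. dual_potential f c l x \<partial>\<mu>) else \<infinity>)"
proof -
  obtain b where "\<And>y. b \<le> f y"
    using f_bounded_below by blast
  then show ?thesis
    using measurable_dual_potential[OF assms] dual_potential_ge[OF assms]
    by (intro ext_integral_bounded_below[of _ _ b]) (simp_all add: finite_measure_axioms measurable_cong_sets[OF sets_mu refl])
qed

section \<open>Lagrangian lower bound for the primal value\<close>

lemma weak_duality: "dual_value f c \<mu> r \<le> primal_value f c \<mu> r"
  unfolding primal_value_eq dual_value_def
proof (intro SUP_least INF_greatest)
  fix l \<pi> assume "l \<in> {0::real..}"
    and "\<pi> \<in> {\<pi> \<in> borel_probs. distr \<pi> borel fst = \<mu> \<and> ext_integral \<pi> c \<le> ereal r}"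
  then have l: "0 \<le> l" and \<pi>: "\<pi> \<in> borel_probs" "distr \<pi> borel fst = \<mu>"
    and cost: "ext_integral \<pi> c \<le> ereal r"
    by auto
  interpret \<pi>: prob_space \<pi>
    using \<pi>(1) by (simp add: space_prob_algebra)
  have sets_\<pi> [measurable_cong]: "sets \<pi> = sets borel"
    using \<pi>(1) by (simp add: space_prob_algebra)
  have fst [measurable]: "fst \<in> \<pi> \<rightarrow>\<^sub>M borel"
    using borel_measurable_fst by (simp add: measurable_cong_sets[OF sets_\<pi> refl])
  obtain b where b: "\<And>y. b \<le> f y"
    using f_bounded_below by blast
  let ?\<phi> = "dual_potential f c l"
  have [measurable]: "?\<phi> \<in> borel_measurable borel"
    by (rule measurable_dual_potential[OF l])
  have c: "integrable \<pi> c" "(\<integral>p. c p \<partial>\<pi>) \<le> r"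
    using cost ext_integral_bounded_below[of \<pi> c 0] c_nonneg \<pi>.finite_measure_axioms
    by (simp_all split: if_splits)
  have ext_f: "ext_integral \<pi> (\<lambda>(x, y). f y) = (if integrable \<pi> (\<lambda>(x, y). f y)
      then ereal (\<integral>(x, y). f y \<partial>\<pi>) else \<infinity>)"
    using b by (intro ext_integral_bounded_below[of _ _ b] \<pi>.finite_measure_axioms) auto
  show "ext_integral \<mu> ?\<phi> - ereal (l * r) \<le> ext_integral \<pi> (\<lambda>(x, y). f y)"
  \<comment> \<open>If \<open>f\<close> is not integrable, the right-hand side is infinite.\<close>
  proof (cases "integrable \<pi> (\<lambda>(x, y). f y)")
    case True
    let ?L = "\<lambda>p. (case p of (x, y) \<Rightarrow> f y) + l * c p"
    have L: "integrable \<pi> ?L"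
      using True c(1) by simp
    have le: "?\<phi> (fst p) \<le> ?L p" for p
      using dual_potential_le[OF l, of "fst p" "snd p"] by (simp add: case_prod_beta)
    \<comment> \<open>The potential lies between the constant \<open>b\<close> and the integrable
      Lagrangian.\<close>
    have int: "integrable \<pi> (\<lambda>p. ?\<phi> (fst p))"
    proof (rule Bochner_Integration.integrable_bound)
      show "integrable \<pi> (\<lambda>p. \<bar>?L p\<bar> + \<bar>b\<bar>)"
        using L by simp
      show "AE p in \<pi>. norm (?\<phi> (fst p)) \<le> norm (\<bar>?L p\<bar> + \<bar>b\<bar>)"
        using le dual_potential_ge[OF l b] by (intro AE_I2) (smt (verit) real_norm_def)
    qed measurable
    have "integrable \<mu> ?\<phi>" "(\<integral>x. ?\<phi> x \<partial>\<mu>) = (\<integral>p. ?\<phi> (fst p) \<partial>\<pi>)"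
      using int integrable_distr_eq[OF fst, of ?\<phi>] integral_distr[OF fst, of ?\<phi>] by (simp_all add: \<pi>(2))
    moreover have "(\<integral>p. ?\<phi> (fst p) \<partial>\<pi>) \<le> (\<integral>p. ?L p \<partial>\<pi>)"
      using int L le by (rule integral_mono)
    moreover have "(\<integral>p. ?L p \<partial>\<pi>) = (\<integral>(x, y). f y \<partial>\<pi>) + l * (\<integral>p. c p \<partial>\<pi>)"
      using True c(1) by simp
    moreover have "l * (\<integral>p. c p \<partial>\<pi>) \<le> l * r"
      using c(2) l by (rule mult_left_mono)
    ultimately show ?thesis
      using True by (simp add: ext_f ext_integral_dual_potential[OF l])
  qed (simp add: ext_f)
qed

section \<open>Upper bounds for the primal value from graph plans and their mixtures\<close>

lemma primal_value_le:
  assumes "\<pi> \<in> borel_probs" "distr \<pi> borel fst = \<mu>"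
    and "has_bochner_integral \<pi> c C" "C \<le> r"
    and "has_bochner_integral \<pi> (\<lambda>(x, y). f y) F"
  shows "primal_value f c \<mu> r \<le> ereal F"
  unfolding primal_value_eq
proof (rule INF_lower2)
  show "ext_integral \<pi> (\<lambda>(x, y). f y) \<le> ereal F"
    using assms(5) by (simp add: has_bochner_integral_iff ext_integral_integrable)
  show "\<pi> \<in> {\<pi> \<in> borel_probs. distr \<pi> borel fst = \<mu> \<and> ext_integral \<pi> c \<le> ereal r}"
    using assms by (auto simp: has_bochner_integral_iff ext_integral_integrable)
qed

definition graph_plan :: "('a \<Rightarrow> 'a) \<Rightarrow> ('a \<times> 'a) measure" where
  "graph_plan T = distr \<mu> borel (\<lambda>x. (x, T x))"

lemma graph_plan:
  assumes "T \<in> borel_measurable borel"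
  shows "graph_plan T \<in> borel_probs" "distr (graph_plan T) borel fst = \<mu>"
    "g \<in> borel_measurable borel \<Longrightarrow> integrable \<mu> (\<lambda>x. g (x, T x)) \<Longrightarrow>
      has_bochner_integral (graph_plan T) g (\<integral>x. g (x, T x) \<partial>\<mu> :: real)"
proof -
  note m = measurable_graph[OF assms]
  show "graph_plan T \<in> borel_probs"
    using prob_space_distr[OF m] by (simp add: graph_plan_def space_prob_algebra)
  have "distr (graph_plan T) borel fst = distr \<mu> borel (fst \<circ> (\<lambda>x. (x, T x)))"
    unfolding graph_plan_def
    by (intro distr_distr m borel_measurable_fst)
  also have "\<dots> = \<mu>"
    using distr_id2[OF sets_mu[symmetric]] by (simp add: comp_def)
  finally show "distr (graph_plan T) borel fst = \<mu>" .
  show "has_bochner_integral (graph_plan T) g (\<integral>x. g (x, T x) \<partial>\<mu>)"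
    if "g \<in> borel_measurable borel" "integrable \<mu> (\<lambda>x. g (x, T x))"
    unfolding graph_plan_def has_bochner_integral_iff
    using that integrable_distr_eq[OF m, of g] integral_distr[OF m, of g] by simp
qed

lemma primal_value_le_graph:
  assumes "T \<in> borel_measurable borel"
    and "integrable \<mu> (\<lambda>x. c (x, T x))" "(\<integral>x. c (x, T x) \<partial>\<mu>) \<le> r"
    and "integrable \<mu> (\<lambda>x. f (T x))"
  shows "primal_value f c \<mu> r \<le> ereal (\<integral>x. f (T x) \<partial>\<mu>)"
  using assms(3) graph_plan(3)[OF assms(1) measurable_f_snd]
  by (intro primal_value_le[OF graph_plan(1,2)[OF assms(1)]
        graph_plan(3)[OF assms(1) measurable_c assms(2)]]) (simp_all add: assms(4))

text \<open>The plans are mixed, not the maps: the mixture need not live on a graph, but its first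
  marginal is still \<mu>, and cost and value are affine in the plan.\<close>

lemma primal_value_le_mixture:
  assumes S: "S \<in> borel_measurable borel"
      "integrable \<mu> (\<lambda>x. c (x, S x))" "integrable \<mu> (\<lambda>x. f (S x))"
    and T: "T \<in> borel_measurable borel"
      "integrable \<mu> (\<lambda>x. c (x, T x))" "integrable \<mu> (\<lambda>x. f (T x))"
    and a: "0 \<le> a" "a \<le> 1"
    and cost: "a * (\<integral>x. c (x, S x) \<partial>\<mu>) + (1 - a) * (\<integral>x. c (x, T x) \<partial>\<mu>) \<le> r"
  shows "primal_value f c \<mu> r \<le> ereal (a * (\<integral>x. f (S x) \<partial>\<mu>) + (1 - a) * (\<integral>x. f (T x) \<partial>\<mu>))"
proof -
  note gS = graph_plan[OF S(1)] and gT = graph_plan[OF T(1)]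
  obtain R where R: "R \<in> borel_probs"
    "\<And>g. g \<in> borel_measurable borel \<Longrightarrow> (\<integral>\<^sup>+p. g p \<partial>R) =
      (\<integral>\<^sup>+p. g p \<partial>graph_plan S) * ennreal a + (\<integral>\<^sup>+p. g p \<partial>graph_plan T) * ennreal (1 - a)"
    using mixture_exists[OF gS(1) gT(1) a] by blast
  have sets: "sets R = sets borel" "sets (graph_plan S) = sets borel" "sets (graph_plan T) = sets borel"
    using R(1) gS(1) gT(1) by (simp_all add: space_prob_algebra)
  note mix = mixture_has_bochner_integral[OF R(2) sets a]
  have "has_bochner_integral R g (a * (\<integral>x. g (x, S x) \<partial>\<mu>) + (1 - a) * (\<integral>x. g (x, T x) \<partial>\<mu>))"
    if "g \<in> borel_measurable borel" "integrable \<mu> (\<lambda>x. g (x, S x))" "integrable \<mu> (\<lambda>x. g (x, T x))"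
    for g :: "'a \<times> 'a \<Rightarrow> real"
    using mix[of g] gS(3)[OF that(1,2)] gT(3)[OF that(1,3)] by (simp add: has_bochner_integral_iff)
  from this[OF measurable_c S(2) T(2)] this[OF measurable_f_snd] show ?thesis
    using S(3) T(3) cost
    by (intro primal_value_le[OF R(1) mixture_distr[OF R(2) sets a borel_measurable_fst gS(2) gT(2)]])
      simp_all
qed

section \<open>Consequences of a real upper bound on the dual value\<close>

lemma dual_value_bound:
  assumes D: "dual_value f c \<mu> r \<le> ereal D" and l: "0 \<le> l"
  shows "integrable \<mu> (dual_potential f c l)"
    "(\<integral>x. dual_potential f c l x \<partial>\<mu>) \<le> D + l * r"
proof -
  have "ext_integral \<mu> (dual_potential f c l) - ereal (l * r) \<le> dual_value f c \<mu> r"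
    unfolding dual_value_def using l by (intro SUP_upper) simp
  also note D
  finally have "ext_integral \<mu> (dual_potential f c l) - ereal (l * r) \<le> ereal D" .
  \<comment> \<open>A real bound excludes \<infinity>, which \<open>ext_integral\<close> takes when
    the potential is not integrable.\<close>
  then show "integrable \<mu> (dual_potential f c l)"
    "(\<integral>x. dual_potential f c l x \<partial>\<mu>) \<le> D + l * r"
    by (auto simp: ext_integral_dual_potential[OF l] split: if_splits)
qed

text \<open>Since \<open>f\<close> is at least some \<open>b\<close>, the cost
  \<open>c (x, T x)\<close> is at most the potential minus \<open>b\<close>, divided by
  \<open>l\<close>; this is where \<open>l\<close> must be positive. Then \<open>f (T x)\<close> is
  a difference of integrable functions, and the last claim integrates the equation defining
  \<open>T\<close>.\<close>

lemma optimal_map_integrable: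
  assumes D: "dual_value f c \<mu> r \<le> ereal D" and l: "0 < l"
    and T: "T \<in> borel_measurable borel" "\<And>x. dual_potential f c l x = f (T x) + l * c (x, T x)"
  shows "integrable \<mu> (\<lambda>x. c (x, T x))" "integrable \<mu> (\<lambda>x. f (T x))"
    "(\<integral>x. f (T x) \<partial>\<mu>) + l * (\<integral>x. c (x, T x) \<partial>\<mu>) \<le> D + l * r"
proof -
  let ?\<phi> = "dual_potential f c l"
  note dual = dual_value_bound[OF D less_imp_le[OF l]]
  obtain b where b: "\<And>y. b \<le> f y"
    using f_bounded_below by blast
  show c: "integrable \<mu> (\<lambda>x. c (x, T x))"
  proof (rule Bochner_Integration.integrable_bound)
    show "integrable \<mu> (\<lambda>x. (?\<phi> x - b) / l)"
      using dual(1) by simp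
    show "(\<lambda>x. c (x, T x)) \<in> borel_measurable \<mu>"
      by (rule measurable_compose[OF measurable_graph[OF T(1)] measurable_c])
    show "AE x in \<mu>. norm (c (x, T x)) \<le> norm ((?\<phi> x - b) / l)"
    proof (intro AE_I2)
      fix x
      have "l * c (x, T x) \<le> ?\<phi> x - b"
        using b T(2) by simp
      then have "c (x, T x) \<le> (?\<phi> x - b) / l"
        using l by (simp add: field_simps)
      then show "norm (c (x, T x)) \<le> norm ((?\<phi> x - b) / l)"
        using c_nonneg[of "(x, T x)"] abs_ge_self[of "(?\<phi> x - b) / l"] by simp
    qed
  qed
  have "integrable \<mu> (\<lambda>x. ?\<phi> x - l * c (x, T x))"
    using dual(1) c by simp
  then show f: "integrable \<mu> (\<lambda>x. f (T x))"
    by (simp add: T(2))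
  show "(\<integral>x. f (T x) \<partial>\<mu>) + l * (\<integral>x. c (x, T x) \<partial>\<mu>) \<le> D + l * r"
    using dual(2) c f by (simp add: T(2))
qed

text \<open>The growing penalty pushes \<open>T k x\<close> towards the minimizers of
  \<open>c (x, _)\<close>. As \<open>S x\<close> has the least \<open>f\<close> among these, lower
  semicontinuity and compactness keep \<open>f (T k x)\<close> eventually above any number below
  \<open>f (S x)\<close>.\<close>

lemma primal_value_le_limit:
  assumes D: "dual_value f c \<mu> r \<le> ereal D"
    and l: "\<And>k. 0 < l k" "filterlim l at_top sequentially"
    and T: "\<And>k. T k \<in> borel_measurable borel"
      "\<And>k x. dual_potential f c (l k) x = f (T k x) + l k * c (x, T k x)"
    and expensive: "\<And>k. r \<le> (\<integral>x. c (x, T k x) \<partial>\<mu>)"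
  shows "primal_value f c \<mu> r \<le> ereal D"
proof -
  note opt = optimal_map_integrable[OF D l(1) T]
  obtain b where b: "\<And>y. b \<le> f y"
    using f_bounded_below by blast
  have "lower_semicontinuous (\<lambda>p::'a \<times> 'a. f (snd p))"
    by (rule lower_semicontinuous_compose[OF lsc_f continuous_on_snd[OF continuous_on_id]])
  from measurable_lexicographic_argmin[OF compact_UNIV compact_UNIV lsc_c this]
  obtain S where S: "S \<in> borel_measurable borel" "\<And>x y. c (x, S x) \<le> c (x, y)"
    "\<And>x y. c (x, y) \<le> c (x, S x) \<Longrightarrow> f (S x) \<le> f y"
    by auto
  note [measurable] = S(1) T(1)
  have c: "integrable \<mu> (\<lambda>x. c (x, S x))"
    using opt(1)[of 0] measurable_compose[OF measurable_graph[OF S(1)] measurable_c]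
    by (rule Bochner_Integration.integrable_bound) (use S(2) c_nonneg in auto)
  have lim0: "(\<lambda>k. A / l k) \<longlonglongrightarrow> 0" for A
    by (intro real_tendsto_divide_at_top[OF tendsto_const] l(2))
  \<comment> \<open>\<open>S\<close> costs no more than \<open>T k\<close>, whose cost exceeds
    \<open>r\<close> by at most \<open>(D - b) / l k\<close> because the integral of
    \<open>f\<close> is at least \<open>b\<close>.\<close>
  have "(\<integral>x. c (x, S x) \<partial>\<mu>) \<le> r + (D - b) / l k" for k
  proof -
    have "b \<le> (\<integral>x. f (T k x) \<partial>\<mu>)"
      using integral_mono[of \<mu> "\<lambda>x. b" "\<lambda>x. f (T k x)"] opt(2)[of k] b by (simp add: prob_space)
    then have "(\<integral>x. c (x, T k x) \<partial>\<mu>) \<le> r + (D - b) / l k"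
      using opt(3)[of k] l(1)[of k] by (simp add: field_simps)
    moreover have "(\<integral>x. c (x, S x) \<partial>\<mu>) \<le> (\<integral>x. c (x, T k x) \<partial>\<mu>)"
      by (intro integral_mono c opt(1) S(2))
    ultimately show ?thesis
      by linarith
  qed
  then have cost: "(\<integral>x. c (x, S x) \<partial>\<mu>) \<le> r"
    using tendsto_add[OF tendsto_const[of r] lim0[of "D - b"]]
    by (intro LIMSEQ_le_const[of "\<lambda>k. r + (D - b) / l k" r]) auto
  \<comment> \<open>The cost of at least \<open>r\<close> absorbs the term \<open>l k * r\<close> of
    the dual bound.\<close>
  have f_T: "(\<integral>x. f (T k x) \<partial>\<mu>) \<le> D" for k
  proof -
    have "l k * r \<le> l k * (\<integral>x. c (x, T k x) \<partial>\<mu>)"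
      using expensive[of k] less_imp_le[OF l(1)[of k]] by (rule mult_left_mono)
    then show ?thesis
      using opt(3)[of k] by linarith
  qed
  have ev: "\<forall>\<^sub>F k in sequentially. a < f (T k x)" if a: "a < f (S x)" for a x
  proof (cases "{y. f y \<le> a} = {}")
    case True
    then show ?thesis
      by (auto simp: not_le[symmetric] intro!: always_eventually)
  next
    case False
    have slice: "lower_semicontinuous (\<lambda>y. c (x, y))"
      by (intro lower_semicontinuous_compose[OF lsc_c] continuous_intros)
    have "compact {y. f y \<le> a}"
      using compact_Int_closed[OF compact_UNIV lower_semicontinuous_closed[OF lsc_f, of a]] by simp
    from lower_semicontinuous_attains_min_on[OF slice this False]
    obtain y where y: "f y \<le> a" "\<And>z. f z \<le> a \<Longrightarrow> c (x, y) \<le> c (x, z)"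
      by auto
    \<comment> \<open>Points with \<open>f \<le> a\<close> cost strictly more than \<open>S x\<close>, uniformly by compactness, so \<open>T k x\<close>
      eventually avoids them.\<close>
    have gap: "c (x, S x) < c (x, y)"
      using S(3)[of x y] a y(1) by force
    have "\<forall>\<^sub>F k in sequentially. (f (S x) - b) / l k < c (x, y) - c (x, S x)"
      using gap by (intro order_tendstoD(2)[OF lim0]) simp
    then show ?thesis
    proof eventually_elim
      case (elim k)
      \<comment> \<open>With \<open>S x\<close> as competitor, the excess cost of
        \<open>T k x\<close> is at most \<open>(f (S x) - b) / l k\<close>, which is below the gap
        for large \<open>k\<close>.\<close>
      have "f (T k x) + l k * c (x, T k x) \<le> f (S x) + l k * c (x, S x)"
        using dual_potential_le[of "l k" x "S x"] l(1)[of k] by (simp add: T(2) less_imp_le)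
      then have "l k * c (x, T k x) \<le> l k * c (x, S x) + (f (S x) - b)"
        using b[of "T k x"] by simp
      then have "c (x, T k x) \<le> c (x, S x) + (f (S x) - b) / l k"
        using l(1)[of k] by (simp add: field_simps)
      then have "c (x, T k x) < c (x, y)"
        using elim by simp
      then show ?case
        using y(2)[of "T k x"] by force
    qed
  qed
  \<comment> \<open>Subtracting \<open>b\<close> makes the functions nonnegative, as Fatou's lemma
    requires.\<close>
  have pointwise: "ennreal (f (S x) - b) \<le> liminf (\<lambda>k. ennreal (f (T k x) - b))" for x
    unfolding le_Liminf_iff
  proof (intro allI impI)
    fix z assume z: "z < ennreal (f (S x) - b)"
    then obtain a where a: "z = ennreal a" "0 \<le> a"
      by (cases z) auto
    with z have "a + b < f (S x)"
      by (simp add: ennreal_less_iff)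
    from ev[OF this] show "\<forall>\<^sub>F k in sequentially. z < ennreal (f (T k x) - b)"
      by eventually_elim (simp add: a ennreal_less_iff)
  qed
  \<comment> \<open>This ensures that \<open>ennreal (D - b)\<close> is not truncated to 0, so the
    Fatou bound can be read back in the reals.\<close>
  have bD: "b \<le> D"
    using f_T[of 0] integral_mono[of \<mu> "\<lambda>x. b" "\<lambda>x. f (T 0 x)"] opt(2)[of 0] b
    by (simp add: prob_space)
  have "(\<integral>\<^sup>+x. ennreal (f (S x) - b) \<partial>\<mu>) \<le> (\<integral>\<^sup>+x. liminf (\<lambda>k. ennreal (f (T k x) - b)) \<partial>\<mu>)"
    by (intro nn_integral_mono pointwise)
  also have "\<dots> \<le> liminf (\<lambda>k. \<integral>\<^sup>+x. ennreal (f (T k x) - b) \<partial>\<mu>)"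
    by (intro nn_integral_liminf) measurable
  also have "\<dots> \<le> liminf (\<lambda>k::nat. ennreal (D - b))"
  proof (intro Liminf_mono always_eventually allI)
    fix k
    have "(\<integral>\<^sup>+x. ennreal (f (T k x) - b) \<partial>\<mu>) = ennreal (\<integral>x. f (T k x) - b \<partial>\<mu>)"
      using opt(2)[of k] b by (intro nn_integral_eq_integral) auto
    also have "\<dots> \<le> ennreal (D - b)"
      using f_T[of k] opt(2)[of k] by (intro ennreal_leI) (simp add: prob_space)
    finally show "(\<integral>\<^sup>+x. ennreal (f (T k x) - b) \<partial>\<mu>) \<le> ennreal (D - b)" .
  qed
  finally have fatou: "(\<integral>\<^sup>+x. ennreal (f (S x) - b) \<partial>\<mu>) \<le> ennreal (D - b)"
    by (simp add: Liminf_const)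
  have "integrable \<mu> (\<lambda>x. f (S x) - b)"
    using fatou b by (intro integrableI_nonneg) (auto intro: le_less_trans)
  then have f: "integrable \<mu> (\<lambda>x. f (S x))"
    using Bochner_Integration.integrable_add[of \<mu> "\<lambda>x. f (S x) - b" "\<lambda>x. b"] by simp
  have "ennreal (\<integral>x. f (S x) - b \<partial>\<mu>) \<le> ennreal (D - b)"
    using fatou b nn_integral_eq_integral[OF \<open>integrable \<mu> (\<lambda>x. f (S x) - b)\<close>] by simp
  then have "(\<integral>x. f (S x) \<partial>\<mu>) \<le> D"
    using bD f by (simp add: ennreal_le_iff prob_space)
  then show ?thesis
    using primal_value_le_graph[OF S(1) c cost f] by (meson ereal_less_eq(3) order_trans)
qed

section \<open>Closing the duality gap along a grid of multipliers\<close>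

lemma primal_value_le_dual_bound:
  assumes D: "dual_value f c \<mu> r \<le> ereal D" and e: "0 < e"
  shows "primal_value f c \<mu> r \<le> ereal (D + e * r)"
proof -
  \<comment> \<open>The grid starts at \<open>e\<close> and not at 0, since integrability along the
    optimal maps rests on a positive multiplier.\<close>
  define l where "l k = real (Suc k) * e" for k
  have l: "0 < l k" for k
    using e by (simp add: l_def)
  have "\<forall>k. \<exists>T. T \<in> borel_measurable borel \<and>
      (\<forall>x. dual_potential f c (l k) x = f (T x) + l k * c (x, T x))"
    using optimal_map[OF less_imp_le[OF l]] by metis
  then obtain T where T: "\<And>k. T k \<in> borel_measurable borel"
    "\<And>k x. dual_potential f c (l k) x = f (T k x) + l k * c (x, T k x)"
    by metis
  note opt = optimal_map_integrable[OF D l T]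
  define C where "C k = (\<integral>x. c (x, T k x) \<partial>\<mu>)" for k
  define F where "F k = (\<integral>x. f (T k x) \<partial>\<mu>)" for k
  have bound: "F k \<le> D + l k * (r - C k)" for k
    using opt(3)[of k] by (simp add: C_def F_def algebra_simps)
  have C_nonneg: "0 \<le> C k" for k
    unfolding C_def by (rule Bochner_Integration.integral_nonneg) (rule c_nonneg)
  show ?thesis
  proof (cases "\<exists>k. C k \<le> r")
    case False
    have "filterlim l at_top sequentially"
      unfolding l_def by (intro filterlim_at_top_mult_tendsto_pos[OF tendsto_const e]
          filterlim_compose[OF filterlim_real_sequentially filterlim_Suc])
    then have "primal_value f c \<mu> r \<le> ereal D"
      using False by (intro primal_value_le_limit[OF D l _ T]) (auto simp: C_def not_le less_imp_le)
    also have "\<dots> \<le> ereal (D + e * r)"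
      using e r_nonneg by simp
    finally show ?thesis .
  next
    case True
    define n where "n = (LEAST k. C k \<le> r)"
    have n: "C n \<le> r"
      using True unfolding n_def by (rule LeastI_ex)
    show ?thesis
    proof (cases n)
      \<comment> \<open>Here the multiplier is \<open>e\<close>, so the slack
        \<open>l n * (r - C n)\<close> is at most \<open>e * r\<close>.\<close>
      case 0
      have "primal_value f c \<mu> r \<le> ereal (F n)"
        using n unfolding F_def C_def by (intro primal_value_le_graph T opt)
      also have "F n \<le> D + e * r"
        using bound[of n] mult_nonneg_nonneg[OF less_imp_le[OF e] C_nonneg[of n]] 0
        by (simp add: l_def right_diff_distrib)
      finally show ?thesis
        by simp
    next
      case (Suc m)
      have m: "r < C m"
        using not_less_Least[of m "\<lambda>k. C k \<le> r"] Suc by (simp add: n_def)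
      \<comment> \<open>The weight for which the mixed cost is exactly \<open>r\<close>; the
        denominator is positive because \<open>C n \<le> r < C m\<close>.\<close>
      define a where "a = (r - C n) / (C m - C n)"
      have a: "0 \<le> a" "a \<le> 1"
        using m n by (simp_all add: a_def)
      have "a * (C m - C n) = r - C n"
        using m n by (simp add: a_def)
      then have cost: "a * C m + (1 - a) * C n = r"
        by (simp add: algebra_simps)
      have "primal_value f c \<mu> r \<le> ereal (a * F m + (1 - a) * F n)"
        using cost unfolding C_def F_def by (intro primal_value_le_mixture T opt a) simp
      also have "a * F m + (1 - a) * F n \<le> D + e * r"
      proof -
        have "a * F m \<le> a * (D + l m * (r - C m))" "(1 - a) * F n \<le> (1 - a) * (D + l n * (r - C n))"
          using a by (auto intro!: mult_left_mono bound)
        moreover have "l n = l m + e"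
          by (simp add: l_def Suc algebra_simps)
        \<comment> \<open>The terms with \<open>l m\<close> combine to a multiple of
          \<open>r\<close> minus the mixed cost, which vanishes. Only the grid step \<open>e\<close>
          times a quantity of at most \<open>r\<close> is left.\<close>
        then have "a * (D + l m * (r - C m)) + (1 - a) * (D + l n * (r - C n)) =
            D + l m * (r - (a * C m + (1 - a) * C n)) + e * ((1 - a) * (r - C n))"
          by (simp add: algebra_simps)
        moreover have "(1 - a) * (r - C n) \<le> 1 * r"
          using a n C_nonneg[of n] by (intro mult_mono) auto
        then have "e * ((1 - a) * (r - C n)) \<le> e * r"
          using e by simp
        ultimately show ?thesis
          by (simp add: cost)
      qed
      finally show ?thesis
        by simp
    qed
  qed
qed

lemma strong_duality: "primal_value f c \<mu> r = dual_value f c \<mu> r"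
proof (rule antisym[OF _ weak_duality])
  \<comment> \<open>The multiplier 0 already gives a term other than -\<infinity>, as the potential
    is bounded below.\<close>
  have "dual_value f c \<mu> r \<noteq> -\<infinity>"
  proof -
    have "ext_integral \<mu> (dual_potential f c 0) - ereal (0 * r) \<le> dual_value f c \<mu> r"
      unfolding dual_value_def by (rule SUP_upper) simp
    then show ?thesis
      by (auto simp: ext_integral_dual_potential split: if_splits)
  qed
  then consider D where "dual_value f c \<mu> r = ereal D" | "dual_value f c \<mu> r = \<infinity>"
    by (cases "dual_value f c \<mu> r") auto
  then show "primal_value f c \<mu> r \<le> dual_value f c \<mu> r"
  proof cases
    case (1 D)
    have "primal_value f c \<mu> r \<le> ereal D + ereal e" if "0 < e" for e
    proof -
      \<comment> \<open>The grid width \<open>e / (r + 1)\<close> keeps the error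
        \<open>e * r / (r + 1)\<close> below \<open>e\<close>, with a denominator that is positive
        for every nonnegative \<open>r\<close>.\<close>
      have "primal_value f c \<mu> r \<le> ereal (D + e / (r + 1) * r)"
        using that r_nonneg 1 by (intro primal_value_le_dual_bound) auto
      also have "e / (r + 1) * r \<le> e"
        using that r_nonneg by (simp add: field_simps)
      finally show ?thesis
        by simp
    qed
    then show ?thesis
      unfolding 1 by (rule ereal_le_epsilon2)
  qed simp
qed

end

theorem corollary1:
  fixes f :: "'a::polish_space \<Rightarrow> real"
    and c :: "'a \<times> 'a \<Rightarrow> real"
    and \<mu> :: "'a measure"
    and r :: real
  assumes "compact (UNIV :: 'a set)"
    and "lower_semicontinuous f"
    and "lower_semicontinuous c"
    and "\<And>p. 0 \<le> c p"
    and "\<mu> \<in> borel_probs"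
    and "0 < r"
  shows "primal_value f c \<mu> r = dual_value f c \<mu> r"
proof -
  interpret transport_problem f c \<mu> r
    using assms by unfold_locales simp_all
  show ?thesis
    by (rule strong_duality)
qed

end
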